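(* Let $n$ be a positive integer. Let $b_1,\dots,b_n$ be nonzero complex numbers such that $b_{n+1-i}=\overline{b_i}$ for all $i=1,\dots,n$. Let $z_1,\dots,z_n$ be distinct complex numbers with $|z_i|=1$ and $z_i\neq 1$ for all $i$, such that $z_{n+1-i}=\overline{z_i}$ for all $i=1,\dots,n$. Then $$\liminf_{k\to\infty}\sum_{j=1}^n b_j z_j^k\le -\frac1n\sum_{j=1}^n|b_j|.$$
   Context: Here $k$ runs through the positive integers. The sum $\sum_{j=1}^n b_jz_j^k$ is real for every integer $k$ because of the conjugacy conditions. *)

theory Defs
  imports "HOL-Analysis.Analysis"
begin

text \<open>
  The conjugate symmetry makes the power sums real, so that taking real parts, as needed to form
  a limit inferior, loses nothing.
\<close>

lemma conjugate_symmetric_power_sum_real: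
  fixes b z :: "nat \<Rightarrow> complex" and n k :: nat
  assumes b: "\<And>i. i \<in> {1..n} \<Longrightarrow> b (n + 1 - i) = cnj (b i)"
    and z: "\<And>i. i \<in> {1..n} \<Longrightarrow> z (n + 1 - i) = cnj (z i)"
  shows "complex_of_real (Re (\<Sum>j=1..n. b j * z j ^ k)) = (\<Sum>j=1..n. b j * z j ^ k)"
proof -
  have "cnj (\<Sum>j=1..n. b j * z j ^ k) = (\<Sum>j=1..n. b (n + 1 - j) * z (n + 1 - j) ^ k)"
    by (simp add: b[simplified] z[simplified])
  also have "\<dots> = (\<Sum>j=1..n. b j * z j ^ k)"
    by (rule sum.reindex_bij_witness[where i = "\<lambda>j. n + 1 - j" and j = "\<lambda>j. n + 1 - j"]) auto
  finally have "(\<Sum>j=1..n. b j * z j ^ k) \<in> \<real>"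
    by (simp only: Reals_cnj_iff)
  then show ?thesis
    by (rule of_real_Re)
qed

end

theory Submission
  imports Defs
begin

text \<open>
  The \<open>b j\<close> are the Fourier coefficients of the real sequence \<open>x k = (\<Sum>j. b j * z j ^ k)\<close>: since the
  \<open>z j\<close> are distinct points of the unit circle, the mean of \<open>x k * cnj (z i) ^ k\<close> over \<open>k\<close> is \<open>b i\<close>.
  Since no \<open>z j\<close> equals 1, the mean of \<open>x\<close> itself is 0, and so is the mean of \<open>cnj (z i) ^ k\<close>.

  If \<open>x k \<ge> r\<close> for all large \<open>k\<close>, then \<open>x - r\<close> is eventually nonnegative with mean \<open>- r\<close>, and each
  Fourier coefficient of a nonnegative sequence is bounded by its mean. The coefficients of
  \<open>x - r\<close> at the frequencies \<open>z i\<close> are the \<open>b i\<close>, so \<open>norm (b i) \<le> - r\<close> for each \<open>i\<close>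
  (\<open>norm_coeff_le_neg_lower_bound\<close>). Summing over \<open>i\<close> shows that every eventual lower bound \<open>r\<close>
  of \<open>x\<close> satisfies \<open>r \<le> - (1 / n) * (\<Sum>i. norm (b i))\<close>, which is the claim about the limit inferior.
\<close>

text \<open>
  For \<open>w \<noteq> 1\<close> the partial sums of the geometric series are bounded by \<open>2 / norm (1 - w)\<close>, so
  dividing by \<open>N\<close> sends them to 0.
\<close>

lemma mean_powers_unit_circle:
  fixes w :: complex
  assumes "norm w = 1"
  shows "(\<lambda>N. (\<Sum>k<N. w ^ k) / of_nat N) \<longlonglongrightarrow> (if w = 1 then 1 else 0)"
proof (cases "w = 1")
  case True
  have "eventually (\<lambda>N. (\<Sum>k<N. w ^ k) / of_nat N = 1) sequentially"
    using eventually_gt_at_top[of 0] by eventually_elim (simp add: True)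
  then show ?thesis
    using True by (simp add: tendsto_eventually)
next
  case False
  have "(\<lambda>N. (\<Sum>k<N. w ^ k) / of_nat N) \<longlonglongrightarrow> 0"
  proof (rule Lim_null_comparison)
    show "eventually (\<lambda>N. norm ((\<Sum>k<N. w ^ k) / of_nat N) \<le> (2 / norm (1 - w)) / real N) sequentially"
    proof (rule always_eventually, rule allI)
      fix N
      have "norm (1 - w ^ N) \<le> 2"
        using norm_triangle_ineq4[of 1 "w ^ N"] assms by (simp add: norm_power)
      then show "norm ((\<Sum>k<N. w ^ k) / of_nat N) \<le> (2 / norm (1 - w)) / real N"
        using False by (simp add: sum_gp_strict norm_divide norm_mult divide_right_mono)
    qed
    show "(\<lambda>N. (2 / norm (1 - w)) / real N) \<longlonglongrightarrow> 0"
      by (rule lim_const_over_n)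
  qed
  then show ?thesis
    using False by simp
qed

lemma mean_exponential_sum:
  fixes b z :: "'a \<Rightarrow> complex"
  assumes "\<And>j. j \<in> A \<Longrightarrow> norm (z j) = 1"
  shows "(\<lambda>N. (\<Sum>k<N. \<Sum>j\<in>A. b j * z j ^ k) / of_nat N)
           \<longlonglongrightarrow> (\<Sum>j\<in>A. b j * (if z j = 1 then 1 else 0))"
proof -
  have "(\<Sum>k<N. \<Sum>j\<in>A. b j * z j ^ k) / of_nat N
          = (\<Sum>j\<in>A. b j * ((\<Sum>k<N. z j ^ k) / of_nat N))" for N
    by (subst sum.swap) (simp add: sum_divide_distrib sum_distrib_left)
  then show ?thesis
    by (simp only:) (intro tendsto_sum tendsto_mult tendsto_const mean_powers_unit_circle assms)
qed

text \<open>
  The bound \<open>norm (b i) \<le> - r\<close> compares two means of the nonnegative sequence \<open>x - r\<close>: the one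
  twisted by \<open>cnj (z i) ^ k\<close>, which tends to \<open>b i\<close>, and the plain one, which tends to \<open>- r\<close>.
\<close>

lemma norm_coeff_le_neg_lower_bound:
  fixes b z :: "'a \<Rightarrow> complex" and x :: "nat \<Rightarrow> real"
  assumes "finite A" and "i \<in> A" and inj: "inj_on z A"
    and unit: "\<And>j. j \<in> A \<Longrightarrow> norm (z j) = 1"
    and ne1: "\<And>j. j \<in> A \<Longrightarrow> z j \<noteq> 1"
    and x: "\<And>k. complex_of_real (x k) = (\<Sum>j\<in>A. b j * z j ^ k)"
    and lower: "\<And>k. r \<le> x k"
  shows "norm (b i) \<le> - r"
proof -
  define w where "w = cnj (z i)"
  have norm_w: "norm w = 1" and "w \<noteq> 1"
    using unit ne1 \<open>i \<in> A\<close> by (auto simp: w_def)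
  have resonance: "z j * w = 1 \<longleftrightarrow> j = i" if "j \<in> A" for j
  proof
    assume "z j * w = 1"
    moreover have "z i * w = 1"
      using unit[OF \<open>i \<in> A\<close>] by (simp add: w_def complex_norm_square[symmetric])
    ultimately have "z j = z i"
      using norm_w by (metis mult_cancel_right norm_zero zero_neq_one)
    then show "j = i"
      using inj that \<open>i \<in> A\<close> by (simp add: inj_on_eq_iff)
  next
    assume "j = i"
    then show "z j * w = 1"
      using unit[OF \<open>i \<in> A\<close>] by (simp add: w_def complex_norm_square[symmetric])
  qed
  have twisted: "(\<lambda>N. (\<Sum>k<N. of_real (x k) * w ^ k) / of_nat N) \<longlonglongrightarrow> b i"
  proof -
    have "(\<lambda>N. (\<Sum>k<N. \<Sum>j\<in>A. b j * (z j * w) ^ k) / of_nat N)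
            \<longlonglongrightarrow> (\<Sum>j\<in>A. b j * (if z j * w = 1 then 1 else 0))"
      by (rule mean_exponential_sum) (simp add: norm_mult unit norm_w)
    also have "(\<Sum>j\<in>A. b j * (if z j * w = 1 then 1 else 0)) = (\<Sum>j\<in>A. if j = i then b j else 0)"
      by (rule sum.cong) (simp_all add: resonance)
    also have "\<dots> = b i"
      using \<open>finite A\<close> \<open>i \<in> A\<close> by simp
    finally show ?thesis
      by (simp add: x sum_distrib_right power_mult_distrib mult.assoc)
  qed
  have plain: "(\<lambda>N. (\<Sum>k<N. of_real (x k)) / of_nat N :: complex) \<longlonglongrightarrow> 0"
    using mean_exponential_sum[of A z b] unit ne1 by (simp add: x)
  have "(\<lambda>N. norm ((\<Sum>k<N. of_real (x k) * w ^ k) / of_nat N - of_real r * ((\<Sum>k<N. w ^ k) / of_nat N)))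
          \<longlonglongrightarrow> norm (b i - of_real r * 0)"
    using mean_powers_unit_circle[OF norm_w] \<open>w \<noteq> 1\<close>
    by (intro tendsto_norm tendsto_diff tendsto_mult tendsto_const twisted) simp
  moreover have "(\<lambda>N. Re ((\<Sum>k<N. of_real (x k)) / of_nat N) - r) \<longlonglongrightarrow> Re 0 - r"
    by (intro tendsto_diff tendsto_const tendsto_Re plain)
  moreover have "norm ((\<Sum>k<N. of_real (x k) * w ^ k) / of_nat N - of_real r * ((\<Sum>k<N. w ^ k) / of_nat N))
        \<le> Re ((\<Sum>k<N. of_real (x k)) / of_nat N) - r" if "N \<ge> 1" for N
  proof -
    have "(\<Sum>k<N. of_real (x k) * w ^ k) / of_nat N - of_real r * ((\<Sum>k<N. w ^ k) / of_nat N)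
            = (\<Sum>k<N. of_real (x k - r) * w ^ k) / of_nat N"
      by (simp add: sum_subtractf sum_distrib_left diff_divide_distrib left_diff_distrib)
    also have "norm \<dots> \<le> (\<Sum>k<N. x k - r) / real N"
    proof -
      have "norm (\<Sum>k<N. of_real (x k - r) * w ^ k) \<le> (\<Sum>k<N. x k - r)"
        using lower by (intro sum_norm_le) (simp add: norm_mult norm_power norm_w flip: of_real_diff)
      then show ?thesis
        by (simp add: norm_divide divide_right_mono)
    qed
    also have "\<dots> = Re ((\<Sum>k<N. of_real (x k)) / of_nat N) - r"
      using that by (simp add: sum_subtractf diff_divide_distrib)
    finally show ?thesis .
  qed
  ultimately have "norm (b i - of_real r * 0) \<le> Re 0 - r"
    by (intro LIMSEQ_le) auto
  then show ?thesis
    by simp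
qed

theorem corollary1:
  fixes n :: nat and b z :: "nat \<Rightarrow> complex"
  assumes "n \<ge> 1"
    and "\<And>i. i \<in> {1..n} \<Longrightarrow> b i \<noteq> 0"
    and "\<And>i. i \<in> {1..n} \<Longrightarrow> b (n + 1 - i) = cnj (b i)"
    and "inj_on z {1..n}"
    and "\<And>i. i \<in> {1..n} \<Longrightarrow> norm (z i) = 1"
    and "\<And>i. i \<in> {1..n} \<Longrightarrow> z i \<noteq> 1"
    and "\<And>i. i \<in> {1..n} \<Longrightarrow> z (n + 1 - i) = cnj (z i)"
  shows "liminf (\<lambda>k. ereal (Re (\<Sum>j=1..n. b j * z j ^ k)))
           \<le> ereal (- (1 / real n) * (\<Sum>j=1..n. norm (b j)))"
proof (rule ccontr)
  define x where "x k = Re (\<Sum>j=1..n. b j * z j ^ k)" for k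
  assume "\<not> ?thesis"
  then obtain r where r: "- (1 / real n) * (\<Sum>j=1..n. norm (b j)) < r"
    and "ereal r < liminf (\<lambda>k. ereal (x k))"
    unfolding x_def not_le by (auto dest: ereal_dense2)
  then have "eventually (\<lambda>k. ereal r < ereal (x k)) sequentially"
    by (auto dest: less_LiminfD)
  then obtain K where K: "\<And>k. k \<ge> K \<Longrightarrow> r < x k"
    by (auto simp: eventually_sequentially)
  have "norm (b i) \<le> - r" if "i \<in> {1..n}" for i
  proof -
    \<comment> \<open>Shifting the sequence by \<open>K\<close> multiplies \<open>b j\<close> by the unimodular factor \<open>z j ^ K\<close>,
      so the lower bound may be taken to hold from the first term on.\<close>
    have "norm (b i * z i ^ K) \<le> - r"
    proof (rule norm_coeff_le_neg_lower_bound[where A = "{1..n}" and z = z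
          and b = "\<lambda>j. b j * z j ^ K" and x = "\<lambda>k. x (K + k)"])
      show "complex_of_real (x (K + k)) = (\<Sum>j\<in>{1..n}. b j * z j ^ K * z j ^ k)" for k
        using conjugate_symmetric_power_sum_real[of n b z "K + k"] assms(3,7)
        by (simp add: x_def power_add mult.assoc)
      show "r \<le> x (K + k)" for k
        using K[of "K + k"] by simp
    qed (use that assms(4-6) in auto)
    then show ?thesis
      using assms(5)[OF that] by (simp add: norm_mult norm_power)
  qed
  then have "(\<Sum>j=1..n. norm (b j)) \<le> (\<Sum>j=1..n. - r)"
    by (rule sum_mono)
  then have "r \<le> - (1 / real n) * (\<Sum>j=1..n. norm (b j))"
    using \<open>n \<ge> 1\<close> by (simp add: field_simps)
  with r show False
    by simp
qed

end
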